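(* Let $k$ and $d$ be positive integers with $d$ odd and $(p,d)=1$. For every positive integer $N$ and every integer $a$ with $0\le a<dp^N$, define $$\mu_k^{*}(a+dp^N\mathbb{Z}_p)=\mu_{k,q;E}^{*}(a+dp^N\mathbb{Z}_p)=(-1)^a\,[dp^N]_q^{k}\,\frac{[2]_q}{[2]_{q^{dp^N}}}\,\mathcal{E}_{k,q^{dp^N}}\!\left(\frac{a}{dp^N}\right).$$ Then $\mu_k^{*}$ is a measure on $X$.
   Context: $p$ is a fixed odd prime, $\mathbb{C}_p$ is the completion of an algebraic closure of $\mathbb{Q}_p$ with $|p|_p=1/p$, and $q\in\mathbb{C}_p$ satisfies $|q-1|_p<p^{-1/(p-1)}$. Put $q^x=\exp(x\log q)$ (for $|x|_p\le 1$, and more generally whenever the exponential converges; in particular $(q^{dp^N})^{a/(dp^N)}=q^a$). Write $[x]_q=\frac{1-q^x}{1-q}$ (understood as $x$ if $q=1$), and $[n]_{-q}=\frac{1-(-q)^n}{1+q}$ for $n\in\mathbb{N}$. $X=X_d=\varprojlim_N \mathbb{Z}/dp^N\mathbb{Z}$, where $d$ is a fixed positive integer prime to $p$ (so $X_1=\mathbb{Z}_p$). For $0\le a<dp^N$, $a+dp^N\mathbb{Z}_p=\{x\in X: x\equiv a \pmod{dp^N}\}$. For a uniformly differentiable $f:\mathbb{Z}_p\to\mathbb{C}_p$, $\int_{\mathbb{Z}_p} f(x)\,d\mu_{-q}(x)=\lim_{N\to\infty}\frac{1}{[p^N]_{-q}}\sum_{x=0}^{p^N-1} f(x)(-q)^x$.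 The modified $q$-Euler numbers and polynomials are $$\mathcal{E}_{n,q}=\int_{\mathbb{Z}_p}q^{-t}[t]_q^n\,d\mu_{-q}(t),\qquad \mathcal{E}_{n,q}(x)=\int_{\mathbb{Z}_p}q^{-t}[t+x]_q^n\,d\mu_{-q}(t)=\sum_{l=0}^n\binom{n}{l}q^{xl}\mathcal{E}_{l,q}[x]_q^{n-l}.$$ $\mathcal{E}_{k,q^{m}}(x)$ denotes the same polynomial with $q$ replaced by $q^{m}$. A measure on $X$ is a bounded $\mathbb{C}_p$-valued finitely additive function on the compact open subsets of $X$. Being a measure thus means that the values on the sets $a+dp^N\mathbb{Z}_p$ are uniformly bounded and satisfy $\sum_{i=0}^{p-1}\mu(a+idp^N+dp^{N+1}\mathbb{Z}_p)=\mu(a+dp^N\mathbb{Z}_p)$. *)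

theory Defs
  imports "HOL-Analysis.Analysis" "HOL-Computational_Algebra.Polynomial"
begin

section \<open>Ultrametric fields and the field of complex p-adic numbers\<close>

text \<open>
  A field of characteristic 0 with a non-archimedean absolute value \<open>vnorm\<close>; distance,
  topology, limits and series are the library's, taken with respect to this absolute value.
  (The class \<^class>\<open>real_normed_field\<close>, and hence the constant \<^const>\<open>norm\<close>, is unsuitable: it
  forces the archimedean absolute value on the rationals.)  That \<open>vnorm x = 0\<close> holds only for
  \<open>x = 0\<close> comes from \<^class>\<open>metric_space\<close>.
\<close>

class ultrametric_field = field_char_0 + metric_space +
  fixes vnorm :: "'a \<Rightarrow> real"
  assumes dist_vnorm: "dist x y = vnorm (x - y)"
    and vnorm_mult: "vnorm (x * y) = vnorm x * vnorm y"
    and vnorm_add_le_max: "vnorm (x + y) \<le> max (vnorm x) (vnorm y)"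

definition algebraic_over :: "'a::field set \<Rightarrow> 'a set" where
  "algebraic_over F = {x. \<exists>f. f \<noteq> 0 \<and> (\<forall>i. coeff f i \<in> F) \<and> poly f x = 0}"

text \<open>
  The type \<^typ>\<open>'a\<close> is a completion of an algebraic closure of the p-adic numbers.  The p-adic
  numbers are the closure of the rationals in the complete field \<^typ>\<open>'a\<close>, that is, the
  completion of the rationals for the p-adic absolute value, which is determined on the rationals
  by \<open>vnorm_p\<close>.  The elements algebraic over them form an algebraically closed field
  (\<open>alg_closed\<close>), whose completion is \<^typ>\<open>'a\<close> (\<open>algebraic_dense\<close>).
\<close>

locale complex_padic_field =
  fixes p :: nat
  assumes prime_p: "prime p"
    and vnorm_p: "vnorm (of_nat p :: 'a::{ultrametric_field, complete_space}) = 1 / real p"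
    and alg_closed:
      "\<lbrakk>degree (f :: 'a poly) > 0; \<forall>i. coeff f i \<in> algebraic_over (closure \<rat>)\<rbrakk>
        \<Longrightarrow> \<exists>x \<in> algebraic_over (closure \<rat>). poly f x = 0"
    and algebraic_dense: "closure (algebraic_over (closure \<rat>)) = (UNIV :: 'a set)"


section \<open>q-analogues\<close>

definition padic_exp :: "'a::ultrametric_field \<Rightarrow> 'a" where
  "padic_exp x = (\<Sum>n. x ^ n / fact n)"

definition padic_log :: "'a::ultrametric_field \<Rightarrow> 'a" where
  "padic_log x = (\<Sum>n. (- 1) ^ n * (x - 1) ^ Suc n / of_nat (Suc n))"

definition q_power :: "'a::ultrametric_field \<Rightarrow> 'a \<Rightarrow> 'a" where
  "q_power q x = padic_exp (x * padic_log q)"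

definition q_number :: "'a::ultrametric_field \<Rightarrow> 'a \<Rightarrow> 'a" where
  "q_number q x = (if q = 1 then x else (1 - q_power q x) / (1 - q))"

text \<open>This is $[n]_{-q}$; the base $-q$ is outside the domain of the logarithm.\<close>

definition neg_q_number :: "'a::ultrametric_field \<Rightarrow> nat \<Rightarrow> 'a" where
  "neg_q_number q n = (1 - (- q) ^ n) / (1 + q)"

text \<open>The integral over the p-adic integers against $\mu_{-q}$; it only involves the values of the
  integrand at natural numbers.\<close>

definition fermionic_integral :: "nat \<Rightarrow> 'a::ultrametric_field \<Rightarrow> ('a \<Rightarrow> 'a) \<Rightarrow> 'a" where
  "fermionic_integral p q f =
     lim (\<lambda>N. 1 / neg_q_number q (p ^ N) * (\<Sum>x<p ^ N. f (of_nat x) * (- q) ^ x))"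

definition q_euler_poly :: "nat \<Rightarrow> nat \<Rightarrow> 'a::ultrametric_field \<Rightarrow> 'a \<Rightarrow> 'a" where
  "q_euler_poly p n q x =
     fermionic_integral p q (\<lambda>t. q_power q (- t) * q_number q (t + x) ^ n)"

definition mu_star :: "nat \<Rightarrow> nat \<Rightarrow> nat \<Rightarrow> 'a::ultrametric_field \<Rightarrow> nat \<Rightarrow> nat \<Rightarrow> 'a" where
  "mu_star p d k q N a =
     (- 1) ^ a * q_number q (of_nat (d * p ^ N)) ^ k *
     (q_number q 2 / q_number (q ^ (d * p ^ N)) 2) *
     q_euler_poly p k (q ^ (d * p ^ N)) (of_nat a / of_nat (d * p ^ N))"


section \<open>The profinite space X and measures on it\<close>

text \<open>The inverse limit of the rings $\mathbb{Z}/dp^N\mathbb{Z}$, residue classes being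
  represented by their least non-negative elements.\<close>

definition X_set :: "nat \<Rightarrow> nat \<Rightarrow> (nat \<Rightarrow> nat) set" where
  "X_set p d = {x. \<forall>N. x N < d * p ^ N \<and> x (Suc N) mod (d * p ^ N) = x N}"

definition X_top :: "nat \<Rightarrow> nat \<Rightarrow> (nat \<Rightarrow> nat) topology" where
  "X_top p d =
     subtopology (product_topology (\<lambda>N. discrete_topology {..<d * p ^ N}) UNIV) (X_set p d)"

text \<open>The set $a + dp^N\mathbb{Z}_p$, for $0 \leq a < dp^N$.\<close>

definition X_ball :: "nat \<Rightarrow> nat \<Rightarrow> nat \<Rightarrow> nat \<Rightarrow> (nat \<Rightarrow> nat) set" where
  "X_ball p d N a = {x \<in> X_set p d. x N = a}"

definition compact_open :: "'b topology \<Rightarrow> 'b set \<Rightarrow> bool" where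
  "compact_open T U \<longleftrightarrow> compactin T U \<and> openin T U"

definition padic_measure :: "'b topology \<Rightarrow> ('b set \<Rightarrow> 'a::ultrametric_field) \<Rightarrow> bool" where
  "padic_measure T \<mu> \<longleftrightarrow>
     (\<exists>B. \<forall>U. compact_open T U \<longrightarrow> vnorm (\<mu> U) \<le> B) \<and>
     (\<forall>U V. compact_open T U \<longrightarrow> compact_open T V \<longrightarrow> U \<inter> V = {} \<longrightarrow> \<mu> (U \<union> V) = \<mu> U + \<mu> V)"

end

theory Submission
  imports Defs
begin

text \<open>
  The measure is the alternating counting measure of the natural numbers with weight \<open>[n]\<^sub>q\<^sup>k\<close>.
  Embed the natural numbers into \<open>X\<close> and put
  \<open>\<mu>(U) = (1 + q) / 2 \<cdot> lim\<^sub>M \<Sum> (-1)\<^sup>n [n]\<^sub>q\<^sup>k\<close>, the sum extending over the \<open>n < d p\<^sup>M\<close> in \<open>U\<close>.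
  If the limits exist, \<open>\<mu>\<close> is additive, and it is bounded because \<open>\<bar>[n]\<^sub>q\<bar> \<le> 1\<close>
  (\<open>padic_measure_euler_measure\<close>).

  The limits exist (\<open>convergent_euler_sum\<close>): by compactness membership in \<open>U\<close> depends only on the
  residue modulo some \<open>d p\<^sup>N\<close> (\<open>compact_open_X_top_level\<close>), so for \<open>M \<ge> N\<close> and \<open>D = d p\<^sup>M\<close> the
  next sum replaces each \<open>n < D\<close> in \<open>U\<close> by \<open>n, n + D, \<dots>, n + (p - 1) D\<close>.  As \<open>D\<close> is odd their
  signs alternate and, \<open>p\<close> being odd, add up to that of \<open>n\<close>; and
  \<open>[n + j D]\<^sub>q - [n]\<^sub>q = q\<^sup>n [j D]\<^sub>q\<close> has absolute value \<open>\<bar>j D\<bar> \<le> p\<^bsup>-M\<^esup>\<close>.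

  On a ball this is the prescribed value (\<open>mu_star_eq\<close>).  With \<open>F = d p\<^sup>N\<close> and \<open>Q = q\<^sup>F\<close>, the factor
  \<open>Q\<^bsup>-t\<^esup>\<close> in the integrand turns \<open>(-Q)\<^sup>t\<close> into \<open>(-1)\<^sup>t\<close>, so the Euler polynomial at \<open>a / F\<close> is
  \<open>(1 + Q) / 2 \<cdot> lim\<^sub>M \<Sum> (-1)\<^sup>t [t + a / F]\<^sub>Q\<^sup>k\<close> over \<open>t < p\<^sup>M\<close>; and
  \<open>[F]\<^sub>q [t + a / F]\<^sub>Q = [a + F t]\<^sub>q\<close> (\<open>q_number_distribution\<close>), where \<open>a + F t\<close> runs through the
  residue class of \<open>a\<close>.

  The distribution relation rests on \<open>Q\<^bsup>t + a/F\<^esup> = q\<^bsup>a + F t\<^esup>\<close> for powers defined by the \<open>p\<close>-adic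
  exponential and logarithm, hence on the addition theorem of the exponential and on
  \<open>exp (log q) = q\<close> for \<open>\<bar>q - 1\<bar> < p\<^bsup>-1/(p-1)\<^esup>\<close>.  The latter (\<open>padic_exp_log\<close>) is obtained from
  \<open>log q = lim\<^sub>M (q\<^bsup>p^M\<^esup> - 1) / p\<^sup>M\<close>; then \<open>log (q\<^sup>F) = F log q\<close> by injectivity of the exponential.
\<close>

section \<open>Ultrametric absolute values\<close>

lemma vnorm_eq_0_iff [simp]: "vnorm x = 0 \<longleftrightarrow> x = (0 :: 'a::ultrametric_field)"
  using dist_vnorm[of x 0] by (metis diff_zero dist_eq_0_iff)

lemma vnorm_0 [simp]: "vnorm (0 :: 'a::ultrametric_field) = 0"
  by simp

lemma vnorm_nonneg [simp]: "0 \<le> vnorm (x :: 'a::ultrametric_field)"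
  using dist_vnorm[of x 0] by (metis diff_zero zero_le_dist)

lemma vnorm_1 [simp]: "vnorm (1 :: 'a::ultrametric_field) = 1"
  using vnorm_mult[of "1 :: 'a" 1] vnorm_eq_0_iff[of "1 :: 'a"] by simp

lemma vnorm_diff_commute: "vnorm (x - y) = vnorm (y - x :: 'a::ultrametric_field)"
  using dist_vnorm[of x y] dist_vnorm[of y x] by (simp add: dist_commute)

lemma vnorm_minus [simp]: "vnorm (- x) = vnorm (x :: 'a::ultrametric_field)"
  using vnorm_diff_commute[of 0 x] by simp

lemma vnorm_power: "vnorm (x ^ n) = vnorm (x :: 'a::ultrametric_field) ^ n"
  by (induction n) (auto simp: vnorm_mult)

lemma vnorm_divide: "vnorm (x / y) = vnorm x / vnorm (y :: 'a::ultrametric_field)"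
proof (cases "y = 0")
  case False
  then have "vnorm (x / y) * vnorm y = vnorm x"
    using vnorm_mult[of "x / y" y] by simp
  with False show ?thesis by (simp add: field_simps)
qed simp

lemma vnorm_diff_le_max: "vnorm (x - y) \<le> max (vnorm x) (vnorm (y :: 'a::ultrametric_field))"
  using vnorm_add_le_max[of x "- y"] by simp

lemma vnorm_add_le: "vnorm (x + y) \<le> vnorm x + vnorm (y :: 'a::ultrametric_field)"
  using vnorm_add_le_max[of x y] vnorm_nonneg[of x] vnorm_nonneg[of y] by linarith

lemma vnorm_sum_le:
  fixes f :: "'b \<Rightarrow> 'a::ultrametric_field"
  assumes "\<And>i. i \<in> A \<Longrightarrow> vnorm (f i) \<le> B" and "0 \<le> B"
  shows "vnorm (sum f A) \<le> B"
  using assms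
proof (induction A rule: infinite_finite_induct)
  case (insert x A)
  have "vnorm (f x + sum f A) \<le> max (vnorm (f x)) (vnorm (sum f A))"
    by (rule vnorm_add_le_max)
  also have "\<dots> \<le> B" using insert by simp
  finally show ?case using insert by simp
qed auto

lemma vnorm_of_nat_le_1: "vnorm (of_nat n :: 'a::ultrametric_field) \<le> 1"
  using vnorm_sum_le[of "{..<n}" "\<lambda>_. 1 :: 'a" 1] by simp

text \<open>All ultrametric triangles are isosceles.\<close>

lemma vnorm_eq_of_diff_less:
  fixes x y :: "'a::ultrametric_field"
  assumes "vnorm (x - y) < vnorm y"
  shows "vnorm x = vnorm y"
proof (rule antisym)
  show "vnorm x \<le> vnorm y"
    using vnorm_add_le_max[of "x - y" y] assms by simp
  show "vnorm y \<le> vnorm x"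
    using vnorm_diff_le_max[of x "x - y"] assms by simp
qed

lemma tendsto_iff_vnorm:
  fixes f :: "'b \<Rightarrow> 'a::ultrametric_field"
  shows "(f \<longlongrightarrow> L) F \<longleftrightarrow> ((\<lambda>x. vnorm (f x - L)) \<longlongrightarrow> 0) F"
  by (subst tendsto_dist_iff) (simp add: dist_vnorm)

lemma tendsto_vnorm_diff_fst_snd:
  fixes a :: "'a::ultrametric_field" and b :: "'b::ultrametric_field"
  shows "((\<lambda>x. vnorm (fst x - a)) \<longlongrightarrow> 0) (nhds a \<times>\<^sub>F nhds b)"
    and "((\<lambda>x. vnorm (snd x - b)) \<longlongrightarrow> 0) (nhds a \<times>\<^sub>F nhds b)"
  using filterlim_fst[of "nhds a" "nhds b"] filterlim_snd[of "nhds b" "nhds a"]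
  by (simp_all add: tendsto_iff_vnorm[symmetric])

text \<open>With these two instances the limit and series theory of topological rings applies.\<close>

instance ultrametric_field \<subseteq> topological_ab_group_add
proof
  fix a b :: 'a
  show "((\<lambda>x. fst x + snd x) \<longlongrightarrow> a + b) (nhds a \<times>\<^sub>F nhds b)"
    unfolding tendsto_iff_vnorm
  proof (rule tendsto_sandwich[of "\<lambda>_. 0"])
    show "((\<lambda>x. vnorm (fst x - a) + vnorm (snd x - b)) \<longlongrightarrow> 0) (nhds a \<times>\<^sub>F nhds b)"
      using tendsto_add[OF tendsto_vnorm_diff_fst_snd] by simp
    have "vnorm (fst x + snd x - (a + b)) \<le> vnorm (fst x - a) + vnorm (snd x - b)" for x :: "'a \<times> 'a"
      using vnorm_add_le[of "fst x - a" "snd x - b"] by (simp add: algebra_simps)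
    then show "\<forall>\<^sub>F x in nhds a \<times>\<^sub>F nhds b.
        vnorm (fst x + snd x - (a + b)) \<le> vnorm (fst x - a) + vnorm (snd x - b)"
      by simp
  qed auto
  show "(uminus \<longlongrightarrow> - a) (nhds a)"
    unfolding tendsto_iff_vnorm[of uminus]
  proof -
    have "((\<lambda>x. vnorm (x - a)) \<longlongrightarrow> 0) (nhds a)"
      using filterlim_ident[of "nhds a"] tendsto_iff_vnorm[of "\<lambda>x. x" a "nhds a"] by simp
    moreover have "vnorm (- x - - a) = vnorm (x - a)" for x
      using vnorm_diff_commute[of a x] by simp
    ultimately show "((\<lambda>x. vnorm (- x - - a)) \<longlongrightarrow> 0) (nhds a)" by simp
  qed
qed

instance ultrametric_field \<subseteq> topological_semigroup_mult
proof
  fix a b :: 'a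
  show "((\<lambda>x. fst x * snd x) \<longlongrightarrow> a * b) (nhds a \<times>\<^sub>F nhds b)"
    unfolding tendsto_iff_vnorm
  proof (rule tendsto_sandwich[of "\<lambda>_. 0"])
    let ?B = "\<lambda>x. vnorm (fst x - a) * vnorm (snd x - b) + vnorm (fst x - a) * vnorm b
                + vnorm a * vnorm (snd x - b)"
    show "(?B \<longlongrightarrow> 0) (nhds a \<times>\<^sub>F nhds b)"
      by (rule tendsto_eq_intros tendsto_vnorm_diff_fst_snd | simp)+
    have "vnorm (fst x * snd x - a * b) \<le> ?B x" for x :: "'a \<times> 'a"
    proof -
      have "fst x * snd x - a * b =
          ((fst x - a) * (snd x - b) + (fst x - a) * b) + a * (snd x - b)"
        by (simp add: algebra_simps)
      then show ?thesis
        using vnorm_add_le[of "(fst x - a) * (snd x - b) + (fst x - a) * b" "a * (snd x - b)"]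
          vnorm_add_le[of "(fst x - a) * (snd x - b)" "(fst x - a) * b"]
        by (simp add: vnorm_mult)
    qed
    then show "\<forall>\<^sub>F x in nhds a \<times>\<^sub>F nhds b. vnorm (fst x * snd x - a * b) \<le> ?B x"
      by simp
  qed auto
qed

lemma tendsto_vnorm:
  fixes f :: "'b \<Rightarrow> 'a::ultrametric_field"
  assumes "(f \<longlongrightarrow> L) F"
  shows "((\<lambda>x. vnorm (f x)) \<longlongrightarrow> vnorm L) F"
  using tendsto_dist[OF assms tendsto_const[of 0]] by (simp add: dist_vnorm)

lemma tendsto_if_vnorm_le:
  fixes f :: "nat \<Rightarrow> 'a::ultrametric_field"
  assumes "\<And>n. vnorm (f n - L) \<le> g n" and "g \<longlonglongrightarrow> 0"
  shows "f \<longlonglongrightarrow> L"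
  unfolding tendsto_iff_vnorm
  by (rule tendsto_sandwich[OF _ _ tendsto_const assms(2)]) (simp_all add: assms(1))

lemma vnorm_limit_le:
  fixes X :: "nat \<Rightarrow> 'a::ultrametric_field"
  assumes "X \<longlonglongrightarrow> L" and "\<And>n. n \<ge> N \<Longrightarrow> vnorm (X n) \<le> B"
  shows "vnorm L \<le> B"
  using tendsto_vnorm[OF assms(1)] assms(2) by (intro Lim_bounded[where M = N]) auto

text \<open>In an ultrametric the distance of two members of a sequence is bounded by the largest step
  between them.\<close>

lemma convergent_if_steps_tendsto_0:
  fixes X :: "nat \<Rightarrow> 'a::{ultrametric_field, complete_space}"
  assumes "(\<lambda>n. vnorm (X (Suc n) - X n)) \<longlonglongrightarrow> 0"
  shows "convergent X"
proof (rule Cauchy_convergent, rule metric_CauchyI)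
  fix e :: real assume "e > 0"
  then obtain M where M: "\<And>n. n \<ge> M \<Longrightarrow> vnorm (X (Suc n) - X n) < e / 2"
    using order_tendstoD(2)[OF assms, of "e / 2"] by (auto simp: eventually_sequentially)
  have step: "vnorm (X (M + j) - X M) \<le> e / 2" for j
  proof (induction j)
    case (Suc j)
    have "vnorm (X (M + Suc j) - X M) \<le>
        max (vnorm (X (Suc (M + j)) - X (M + j))) (vnorm (X (M + j) - X M))"
      using vnorm_add_le_max[of "X (Suc (M + j)) - X (M + j)" "X (M + j) - X M"] by simp
    with Suc M[of "M + j"] show ?case by simp
  qed (use \<open>e > 0\<close> in simp)
  have "dist (X m) (X n) < e" if "m \<ge> M" "n \<ge> M" for m n
  proof -
    have "vnorm (X m - X n) \<le> max (vnorm (X m - X M)) (vnorm (X n - X M))"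
      using vnorm_diff_le_max[of "X m - X M" "X n - X M"] by simp
    also have "\<dots> \<le> e / 2"
      using step[of "m - M"] step[of "n - M"] that by simp
    finally show ?thesis using \<open>e > 0\<close> by (simp add: dist_vnorm)
  qed
  then show "\<exists>M. \<forall>m\<ge>M. \<forall>n\<ge>M. dist (X m) (X n) < e" by blast
qed

lemma summable_if_terms_tendsto_0:
  fixes f :: "nat \<Rightarrow> 'a::{ultrametric_field, complete_space}"
  assumes "(\<lambda>n. vnorm (f n)) \<longlonglongrightarrow> 0"
  shows "summable f"
  unfolding summable_iff_convergent
  by (rule convergent_if_steps_tendsto_0) (simp add: assms)

section \<open>The q-analogues of the natural numbers\<close>

definition q_int :: "'a::comm_ring_1 \<Rightarrow> nat \<Rightarrow> 'a" where
  "q_int q n = (\<Sum>i<n. q ^ i)"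

lemma q_int_geometric: "q_int q n * (q - 1) = q ^ n - (1 :: 'a::comm_ring_1)"
  by (simp add: q_int_def power_diff_1_eq mult.commute)

lemma q_int_eq_quotient:
  assumes "(q :: 'a::field) \<noteq> 1"
  shows "q_int q n = (1 - q ^ n) / (1 - q)"
  using assms q_int_geometric[of q n] by (simp add: field_simps)

lemma q_int_1: "q_int (1 :: 'a::comm_ring_1) n = of_nat n"
  by (simp add: q_int_def)

lemma q_int_add: "q_int q (n + m) = q_int q n + q ^ n * q_int (q :: 'a::comm_ring_1) m"
  by (induction m) (simp_all add: q_int_def power_add algebra_simps)

section \<open>Absolute values of factorials\<close>

definition exp_radius :: "nat \<Rightarrow> real" where
  "exp_radius p = real p powr (- 1 / (real p - 1))"

context complex_padic_field
begin

abbreviation rad :: real where "rad \<equiv> exp_radius p"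

lemma p_gt_1: "p > 1"
  using prime_p by (rule prime_gt_1_nat)

lemma rad_pos: "0 < rad"
  using p_gt_1 by (simp add: exp_radius_def)

lemma rad_less_1: "rad < 1"
  unfolding exp_radius_def using p_gt_1 by (intro powr_less_one) (auto simp: divide_neg_pos)

lemma rad_power: "rad ^ (p - 1) = 1 / real p"
proof -
  have "rad ^ (p - 1) = real p powr ((- 1 / (real p - 1)) * real (p - 1))"
    using p_gt_1 by (simp add: exp_radius_def powr_realpow[symmetric] powr_powr)
  also have "(- 1 / (real p - 1)) * real (p - 1) = - 1"
    using p_gt_1 by (simp add: of_nat_diff)
  finally show ?thesis using p_gt_1 by (simp add: powr_minus_divide)
qed

lemma vnorm_p_power: "vnorm (of_nat (p ^ m) :: 'a) = (1 / real p) ^ m"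
  by (simp add: vnorm_power vnorm_p)

lemma vnorm_of_nat_coprime:
  assumes "coprime n p"
  shows "vnorm (of_nat n :: 'a) = 1"
proof -
  obtain u v where "u * int n + v * int p = 1"
    using bezout_int[of "int n" "int p"] assms by (auto simp: coprime_iff_gcd_eq_1)
  then have "of_int u * of_nat n + of_int v * of_nat p = (1 :: 'a)"
    by (metis of_int_1 of_int_add of_int_mult of_int_of_nat_eq)
  then have "1 \<le> max (vnorm (of_int u * of_nat n :: 'a)) (vnorm (of_int v * of_nat p :: 'a))"
    using vnorm_add_le_max[of "of_int u * of_nat n :: 'a" "of_int v * of_nat p"] by simp
  moreover have int_le: "vnorm (of_int z :: 'a) \<le> 1" for z
    by (cases z rule: int_cases2) (auto simp: vnorm_of_nat_le_1)
  moreover have "vnorm (of_int v * of_nat p :: 'a) < 1"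
    using mult_right_mono[OF int_le[of v], of "1 / real p"] p_gt_1
    by (simp add: vnorm_mult vnorm_p divide_simps)
  ultimately have "1 \<le> vnorm (of_int u :: 'a) * vnorm (of_nat n :: 'a)"
    by (simp add: vnorm_mult)
  also have "\<dots> \<le> vnorm (of_nat n :: 'a)"
    using mult_right_mono[OF int_le[of u], of "vnorm (of_nat n :: 'a)"] by simp
  finally show ?thesis using vnorm_of_nat_le_1[of n, where 'a = 'a] by simp
qed

lemma coprime_less_p: "0 < s \<Longrightarrow> s < p \<Longrightarrow> coprime s p"
  using prime_p by (metis coprime_commute nat_dvd_not_less prime_imp_coprime)

lemma vnorm_fact_le_1: "vnorm (fact n :: 'a) \<le> 1"
  using vnorm_of_nat_le_1[of "fact n", where 'a = 'a] by simp

text \<open>One block of Legendre's formula: among \<open>1, \<dots>, p m + s\<close> only the multiples of \<open>p\<close> are not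
  units.\<close>

lemma vnorm_fact_block:
  "s < p \<Longrightarrow> vnorm (fact (p * m + s) :: 'a) = (1 / real p) ^ m * vnorm (fact m :: 'a)"
proof (induction m arbitrary: s)
  case 0
  then show ?case
  proof (induction s)
    case (Suc s)
    then show ?case
      using vnorm_of_nat_coprime[OF coprime_less_p[of "Suc s"]] by (simp add: vnorm_mult)
  qed simp
next
  case (Suc m)
  note IH = Suc.IH
  from Suc.prems show ?case
  proof (induction s)
    case 0
    have "p * Suc m + 0 = Suc (p * m + (p - 1))" using p_gt_1 by simp
    then have "(fact (p * Suc m + 0) :: 'a) = of_nat (p * Suc m) * fact (p * m + (p - 1))"
      by (metis add_0_right fact_Suc)
    then have "vnorm (fact (p * Suc m + 0) :: 'a) =
        1 / real p * vnorm (of_nat (Suc m) :: 'a) * vnorm (fact (p * m + (p - 1)) :: 'a)"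
      by (simp only: vnorm_mult of_nat_mult vnorm_p)
    moreover have "vnorm (fact (p * m + (p - 1)) :: 'a) = (1 / real p) ^ m * vnorm (fact m :: 'a)"
      using p_gt_1 by (intro IH) simp
    ultimately show ?case
      by (simp only: fact_Suc vnorm_mult power_Suc mult_ac)
  next
    case (Suc s)
    have "coprime (p * Suc m + Suc s) p"
    proof -
      have "coprime (Suc s) p" using Suc.prems by (intro coprime_less_p) auto
      then show ?thesis by (metis add.commute coprime_iff_gcd_eq_1 gcd.commute gcd_add_mult mult.commute)
    qed
    then have "vnorm (of_nat (p * Suc m + Suc s) :: 'a) = 1" by (rule vnorm_of_nat_coprime)
    moreover have "(fact (p * Suc m + Suc s) :: 'a) =
        of_nat (p * Suc m + Suc s) * fact (p * Suc m + s)"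
      by (metis add_Suc_right fact_Suc)
    ultimately show ?case using Suc by (simp only: vnorm_mult Suc_lessD mult_1_left)
  qed
qed

text \<open>This is \<open>v\<^sub>p((n + 1)!) \<le> n / (p - 1)\<close>, by induction on the blocks of the preceding lemma;
  it is why the exponential converges for \<open>\<bar>x\<bar> < r = p\<^bsup>-1/(p-1)\<^esup>\<close>, and why there the terms of order at
  least 2 are strictly smaller than \<open>x\<close>.\<close>

lemma rad_power_le_vnorm_fact: "rad ^ n \<le> vnorm (fact (Suc n) :: 'a)"
proof (induction n rule: less_induct)
  case (less n)
  define m s where "m = Suc n div p" and "s = Suc n mod p"
  have n: "Suc n = p * m + s" and s: "s < p"
    using p_gt_1 by (simp_all add: m_def s_def)
  have f: "vnorm (fact (Suc n) :: 'a) = (1 / real p) ^ m * vnorm (fact m :: 'a)"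
    using vnorm_fact_block[OF s] n by simp
  show ?case
  proof (cases m)
    case 0
    then show ?thesis using f rad_pos rad_less_1 by (simp add: power_le_one)
  next
    case (Suc m')
    have "p * Suc m' \<le> Suc n" using n Suc by simp
    moreover have "2 * Suc m' \<le> p * Suc m'" using p_gt_1 by (intro mult_right_mono) auto
    ultimately have "m' < n" and le: "(p - 1) * Suc m' + m' \<le> n"
      by (cases p; simp)+
    have "rad ^ n \<le> rad ^ ((p - 1) * Suc m' + m')"
      using rad_pos rad_less_1 le by (intro power_decreasing) auto
    also have "\<dots> = (1 / real p) ^ m * rad ^ m'"
      by (simp only: power_add power_mult rad_power Suc)
    also have "\<dots> \<le> (1 / real p) ^ m * vnorm (fact m :: 'a)"
      using less.IH[OF \<open>m' < n\<close>] Suc by (intro mult_left_mono) auto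
    finally show ?thesis using f by simp
  qed
qed

lemma vnorm_fact_pos: "0 < vnorm (fact n :: 'a)"
  using vnorm_nonneg[of "fact n :: 'a"] vnorm_eq_0_iff[of "fact n :: 'a"] by (simp add: less_le)

lemma vnorm_power_div_fact_le:
  "vnorm (x ^ Suc n / fact (Suc n) :: 'a) \<le> vnorm x * (vnorm x / rad) ^ n"
proof -
  have "vnorm (x ^ Suc n / fact (Suc n)) \<le> vnorm x ^ Suc n / rad ^ n"
    unfolding vnorm_divide vnorm_power
    using rad_power_le_vnorm_fact[of n] rad_pos vnorm_fact_pos[of "Suc n"]
    by (intro divide_left_mono mult_pos_pos) auto
  then show ?thesis by (simp add: power_divide)
qed

lemma vnorm_power_div_le:
  "vnorm (x ^ Suc n / of_nat (Suc n) :: 'a) \<le> vnorm x * (vnorm x / rad) ^ n"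
proof -
  have "vnorm (fact (Suc n) :: 'a) \<le> vnorm (of_nat (Suc n) :: 'a)"
    using mult_left_mono[OF vnorm_fact_le_1[of n], of "vnorm (of_nat (Suc n) :: 'a)"]
    by (simp add: vnorm_mult)
  then have "vnorm x ^ Suc n / vnorm (of_nat (Suc n) :: 'a)
      \<le> vnorm x ^ Suc n / vnorm (fact (Suc n) :: 'a)"
    using vnorm_fact_pos[of "Suc n"] by (intro divide_left_mono mult_pos_pos) auto
  then show ?thesis
    using vnorm_power_div_fact_le[of x n] by (simp only: vnorm_divide vnorm_power)
qed

lemma vnorm_power_div_fact_le':
  assumes "vnorm x < rad"
  shows "vnorm (x ^ n / fact n :: 'a) \<le> (vnorm x / rad) ^ n"
proof (cases n)
  case (Suc m)
  have "vnorm x * (vnorm x / rad) ^ m \<le> vnorm x / rad * (vnorm x / rad) ^ m"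
    using rad_pos rad_less_1 by (intro mult_right_mono) (auto simp: field_simps mult_left_le)
  then show ?thesis using vnorm_power_div_fact_le[of x m] Suc by simp
qed simp

lemma geometric_bound_le:
  assumes "vnorm (x :: 'a) < rad" and "n > 0"
  shows "vnorm x * (vnorm x / rad) ^ n \<le> vnorm x ^ 2 / rad"
proof -
  have "(vnorm x / rad) ^ n \<le> (vnorm x / rad) ^ 1"
    using assms rad_pos by (intro power_decreasing) auto
  then have "vnorm x * (vnorm x / rad) ^ n \<le> vnorm x * (vnorm x / rad) ^ 1"
    by (intro mult_left_mono) auto
  then show ?thesis by (simp add: power2_eq_square)
qed

lemma geometric_bound_tendsto:
  assumes "vnorm (x :: 'a) < rad"
  shows "(\<lambda>n. vnorm x * (vnorm x / rad) ^ n) \<longlonglongrightarrow> 0"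
  using tendsto_mult[OF tendsto_const[of "vnorm x"] LIMSEQ_power_zero[of "vnorm x / rad"]]
    assms rad_pos by simp

lemma square_bound_less:
  assumes "vnorm (x :: 'a) < rad" and "x \<noteq> 0"
  shows "vnorm x ^ 2 / rad < vnorm x"
proof -
  have "vnorm x > 0" using assms(2) vnorm_eq_0_iff[of x] vnorm_nonneg[of x] by linarith
  then show ?thesis using assms(1) rad_pos by (simp add: power2_eq_square field_simps)
qed

section \<open>The exponential\<close>

lemma padic_exp_sums:
  assumes "vnorm (x :: 'a) < rad"
  shows "(\<lambda>n. x ^ n / fact n) sums padic_exp x"
proof -
  have "(\<lambda>n. vnorm (x ^ n / fact n)) \<longlonglongrightarrow> 0"
    using assms rad_pos vnorm_power_div_fact_le'[OF assms]
    by (intro tendsto_sandwich[OF _ _ tendsto_const LIMSEQ_power_zero[of "vnorm x / rad"]]) auto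
  then show ?thesis
    unfolding padic_exp_def by (intro summable_sums summable_if_terms_tendsto_0)
qed

lemma vnorm_padic_exp_first_order:
  assumes "vnorm (x :: 'a) < rad"
  shows "vnorm (padic_exp x - 1 - x) \<le> vnorm x ^ 2 / rad"
proof (rule vnorm_limit_le[where N = 2])
  show "(\<lambda>n. (\<Sum>i<n. x ^ i / fact i) - 1 - x) \<longlonglongrightarrow> padic_exp x - 1 - x"
    using padic_exp_sums[OF assms] unfolding sums_def by (intro tendsto_intros)
  fix n :: nat assume n: "n \<ge> 2"
  have "(\<Sum>i<n. x ^ i / fact i) = (\<Sum>i<2. x ^ i / fact i) + (\<Sum>i=2..<n. x ^ i / fact i)"
    using sum.atLeastLessThan_concat[of 0 2 n "\<lambda>i. x ^ i / fact i"] n by (simp add: lessThan_atLeast0)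
  then have eq: "(\<Sum>i<n. x ^ i / fact i) - 1 - x = (\<Sum>i=2..<n. x ^ i / fact i)"
    by (simp add: numeral_2_eq_2)
  show "vnorm ((\<Sum>i<n. x ^ i / fact i) - 1 - x) \<le> vnorm x ^ 2 / rad"
    unfolding eq
  proof (rule vnorm_sum_le)
    fix i assume "i \<in> {2..<n}"
    then obtain j where j: "i = Suc j" "j > 0" by (cases i) auto
    show "vnorm (x ^ i / fact i) \<le> vnorm x ^ 2 / rad"
      unfolding j(1) using vnorm_power_div_fact_le[of x j] geometric_bound_le[OF assms j(2)]
      by (rule order_trans)
  qed (use rad_pos in auto)
qed

lemma padic_exp_0 [simp]: "padic_exp (0 :: 'a) = 1"
  using vnorm_padic_exp_first_order[of 0] rad_pos vnorm_eq_0_iff[of "padic_exp (0 :: 'a) - 1"]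
    vnorm_nonneg[of "padic_exp (0 :: 'a) - 1"] by simp

lemma vnorm_padic_exp_minus_1:
  assumes "vnorm (x :: 'a) < rad"
  shows "vnorm (padic_exp x - 1) = vnorm x"
proof (cases "x = 0")
  case False
  show ?thesis
    using vnorm_padic_exp_first_order[OF assms] square_bound_less[OF assms False]
    by (intro vnorm_eq_of_diff_less) simp
qed simp

lemma vnorm_padic_exp:
  assumes "vnorm (x :: 'a) < rad"
  shows "vnorm (padic_exp x) = 1"
  using vnorm_padic_exp_minus_1[OF assms] assms rad_less_1
    vnorm_eq_of_diff_less[of "padic_exp x" 1] by simp

lemma vnorm_add_less_rad:
  assumes "vnorm (x :: 'a) < rad" and "vnorm (y :: 'a) < rad"
  shows "vnorm (x + y) < rad"
  using vnorm_add_le_max[of x y] assms by simp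

lemma exp_term_add:
  "(x + y :: 'a) ^ m / fact m = (\<Sum>i\<le>m. x ^ i / fact i * (y ^ (m - i) / fact (m - i)))"
  by (auto simp: binomial_ring sum_divide_distrib binomial_fact field_simps intro!: sum.cong)

text \<open>The square \<open>{..<n} \<times> {..<n}\<close> of the product of two partial sums exceeds the triangle
  \<open>i + j < n\<close> of the partial sum at \<open>x + y\<close> only by terms with \<open>i + j \<ge> n\<close>, each of which is at
  most \<open>\<rho>\<^sup>n\<close> with \<open>\<rho> = max (\<bar>x\<bar>, \<bar>y\<bar>) / r < 1\<close>, and therefore so is their sum.\<close>

lemma padic_exp_add:
  assumes x: "vnorm (x :: 'a) < rad" and y: "vnorm (y :: 'a) < rad"
  shows "padic_exp (x + y) = padic_exp x * padic_exp y"
proof -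
  define E where "E = (\<lambda>(z :: 'a) n. \<Sum>i<n. z ^ i / fact i)"
  have lim: "E z \<longlonglongrightarrow> padic_exp z" if "vnorm z < rad" for z
    using padic_exp_sums[OF that] by (simp add: sums_def E_def)
  define \<rho> where "\<rho> = max (vnorm x) (vnorm y) / rad"
  have \<rho>: "0 \<le> \<rho>" "\<rho> < 1" "vnorm x / rad \<le> \<rho>" "vnorm y / rad \<le> \<rho>"
    using x y rad_pos by (auto simp: \<rho>_def divide_right_mono le_max_iff_disj)
  have bound: "vnorm (E x n * E y n - E (x + y) n) \<le> \<rho> ^ n" for n
  proof -
    define g where "g = (\<lambda>i j. x ^ i / fact i * (y ^ j / fact j))"
    have "E (x + y) n = (\<Sum>k<n. \<Sum>i\<le>k. g i (k - i))"
      by (simp add: E_def exp_term_add g_def)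
    also have "\<dots> = (\<Sum>(i, j) \<in> {(i, j). i + j < n}. g i j)"
      by (rule sum.triangle_reindex[symmetric])
    finally have T: "E (x + y) n = (\<Sum>(i, j) \<in> {(i, j). i + j < n}. g i j)" .
    have S: "E x n * E y n = (\<Sum>(i, j) \<in> {..<n} \<times> {..<n}. g i j)"
      by (simp add: E_def sum_product sum.cartesian_product g_def)
    have "E x n * E y n - E (x + y) n
        = (\<Sum>(i, j) \<in> {..<n} \<times> {..<n} - {(i, j). i + j < n}. g i j)"
      unfolding S T by (rule sum_diff[symmetric]) auto
    moreover have "vnorm (\<Sum>(i, j) \<in> {..<n} \<times> {..<n} - {(i, j). i + j < n}. g i j) \<le> \<rho> ^ n"
    proof (rule vnorm_sum_le)
      fix ij assume "ij \<in> {..<n} \<times> {..<n} - {(i, j). i + j < n}"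
      then obtain i j where ij: "ij = (i, j)" "n \<le> i + j" by (cases ij) auto
      have "vnorm (x ^ i / fact i) \<le> \<rho> ^ i"
        using vnorm_power_div_fact_le'[OF x, of i] power_mono[OF \<rho>(3), of i] rad_pos by simp
      moreover have "vnorm (y ^ j / fact j) \<le> \<rho> ^ j"
        using vnorm_power_div_fact_le'[OF y, of j] power_mono[OF \<rho>(4), of j] rad_pos by simp
      ultimately have "vnorm (g i j) \<le> \<rho> ^ i * \<rho> ^ j"
        unfolding g_def vnorm_mult using \<rho>(1) by (intro mult_mono) auto
      also have "\<dots> \<le> \<rho> ^ n"
        unfolding power_add[symmetric] using \<rho> ij(2) by (intro power_decreasing) auto
      finally show "vnorm (case ij of (i, j) \<Rightarrow> g i j) \<le> \<rho> ^ n" by (simp add: ij(1))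
    qed (use \<rho> in simp)
    ultimately show ?thesis by simp
  qed
  have "(\<lambda>n. E x n * E y n - E (x + y) n) \<longlonglongrightarrow> 0"
    by (rule tendsto_if_vnorm_le[OF _ LIMSEQ_power_zero[of \<rho>]]) (use bound \<rho> in auto)
  moreover have "(\<lambda>n. E x n * E y n - E (x + y) n)
      \<longlonglongrightarrow> padic_exp x * padic_exp y - padic_exp (x + y)"
    by (intro tendsto_intros lim x y vnorm_add_less_rad)
  ultimately have "0 = padic_exp x * padic_exp y - padic_exp (x + y)"
    by (rule LIMSEQ_unique)
  then show ?thesis by simp
qed

lemma vnorm_of_nat_mult_le: "vnorm (of_nat n * x :: 'a) \<le> vnorm x"
  using mult_right_mono[OF vnorm_of_nat_le_1[of n, where 'a = 'a] vnorm_nonneg[of x]]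
  by (simp add: vnorm_mult)

lemma padic_exp_of_nat_mult:
  assumes "vnorm (x :: 'a) < rad"
  shows "padic_exp (of_nat n * x) = padic_exp x ^ n"
proof (induction n)
  case (Suc n)
  have "padic_exp (x + of_nat n * x) = padic_exp x * padic_exp (of_nat n * x)"
    using assms vnorm_of_nat_mult_le[of n x] by (intro padic_exp_add) auto
  then show ?case using Suc by (simp add: algebra_simps)
qed simp

text \<open>In particular the exponential is injective.\<close>

lemma padic_exp_isometry:
  assumes "vnorm (x :: 'a) < rad" and "vnorm (y :: 'a) < rad"
  shows "vnorm (padic_exp x - padic_exp y) = vnorm (x - y)"
proof -
  have xy: "vnorm (x - y) < rad" using vnorm_diff_le_max[of x y] assms by simp
  have "padic_exp x = padic_exp y * padic_exp (x - y)"
    using padic_exp_add[OF assms(2) xy] by simp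
  then have "padic_exp x - padic_exp y = padic_exp y * (padic_exp (x - y) - 1)"
    by (simp add: algebra_simps)
  then show ?thesis
    using vnorm_padic_exp[OF assms(2)] vnorm_padic_exp_minus_1[OF xy] by (simp add: vnorm_mult)
qed

section \<open>The logarithm\<close>

lemma power_minus_1_eq:
  "(1 + u :: 'a) ^ Suc m - 1 =
     of_nat (Suc m) * (\<Sum>j\<le>m. of_nat (m choose j) * (u ^ Suc j / of_nat (Suc j)))"
proof -
  have coef: "(of_nat (Suc m choose Suc j) :: 'a) = of_nat (Suc m) * of_nat (m choose j) / of_nat (Suc j)"
    for j
  proof -
    have "of_nat (Suc j) * (of_nat (Suc m choose Suc j) :: 'a) = of_nat (Suc m) * of_nat (m choose j)"
      unfolding of_nat_mult[symmetric] by (simp only: Suc_times_binomial)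
    then show ?thesis by (simp add: nonzero_eq_divide_eq mult.commute del: of_nat_Suc binomial_Suc_Suc)
  qed
  have "(1 + u) ^ Suc m = (\<Sum>k\<le>Suc m. of_nat (Suc m choose k) * u ^ k)"
    using binomial_ring[of u 1 "Suc m"] by (simp add: add.commute del: power_Suc)
  also have "\<dots> = 1 + (\<Sum>j\<le>m. of_nat (Suc m choose Suc j) * u ^ Suc j)"
    by (subst sum.atMost_Suc_shift) (simp del: power_Suc binomial_Suc_Suc)
  finally show ?thesis
    by (simp add: coef sum_distrib_left mult.assoc del: power_Suc of_nat_Suc binomial_Suc_Suc)
qed

text \<open>In \<open>(1 + u)\<^sup>n - 1 = n (u + \<dots>)\<close> the term \<open>u\<close> dominates.\<close>

lemma vnorm_power_minus_1:
  assumes "vnorm (u :: 'a) < rad"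
  shows "vnorm ((1 + u) ^ n - 1) = vnorm (of_nat n :: 'a) * vnorm u"
proof (cases "n = 0 \<or> u = 0")
  case False
  then obtain m where m: "n = Suc m" by (cases n) auto
  define S where "S = (\<Sum>j\<le>m. of_nat (m choose j) * (u ^ Suc j / of_nat (Suc j)))"
  have "S - u = (\<Sum>j\<in>{1..m}. of_nat (m choose j) * (u ^ Suc j / of_nat (Suc j)))"
    unfolding S_def by (simp add: atMost_atLeast0 sum.atLeast_Suc_atMost)
  moreover have "vnorm (\<Sum>j\<in>{1..m}. of_nat (m choose j) * (u ^ Suc j / of_nat (Suc j)))
      \<le> vnorm u ^ 2 / rad"
  proof (rule vnorm_sum_le)
    fix j assume "j \<in> {1..m}"
    then have "j > 0" by simp
    have "vnorm (of_nat (m choose j) * (u ^ Suc j / of_nat (Suc j))) \<le> vnorm (u ^ Suc j / of_nat (Suc j))"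
      by (rule vnorm_of_nat_mult_le)
    also have "\<dots> \<le> vnorm u ^ 2 / rad"
      using vnorm_power_div_le[of u j] geometric_bound_le[OF assms \<open>j > 0\<close>] by (rule order_trans)
    finally show "vnorm (of_nat (m choose j) * (u ^ Suc j / of_nat (Suc j))) \<le> vnorm u ^ 2 / rad" .
  qed (use rad_pos in auto)
  ultimately have "vnorm (S - u) < vnorm u"
    using square_bound_less[OF assms] False by simp
  then have "vnorm S = vnorm u" by (rule vnorm_eq_of_diff_less)
  then show ?thesis using power_minus_1_eq[of u m] by (simp only: m S_def[symmetric] vnorm_mult)
qed auto

lemma padic_log_sums:
  assumes "vnorm (q - 1 :: 'a) < rad"
  shows "(\<lambda>n. (- 1) ^ n * (q - 1) ^ Suc n / of_nat (Suc n)) sums padic_log q"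
proof -
  have "vnorm ((- 1) ^ n * (q - 1) ^ Suc n / of_nat (Suc n))
      \<le> vnorm (q - 1) * (vnorm (q - 1) / rad) ^ n" for n
    using vnorm_power_div_le[of "q - 1" n] by (simp only: vnorm_divide vnorm_mult vnorm_power) simp
  then have "(\<lambda>n. vnorm ((- 1) ^ n * (q - 1) ^ Suc n / of_nat (Suc n))) \<longlonglongrightarrow> 0"
    by (intro tendsto_sandwich[OF _ _ tendsto_const geometric_bound_tendsto[OF assms]]) auto
  then show ?thesis
    unfolding padic_log_def by (intro summable_sums summable_if_terms_tendsto_0)
qed

lemma vnorm_padic_log_le:
  assumes "vnorm (q - 1 :: 'a) < rad"
  shows "vnorm (padic_log q) \<le> vnorm (q - 1)"
proof (rule vnorm_limit_le[where N = 0])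
  show "(\<lambda>n. \<Sum>i<n. (- 1) ^ i * (q - 1) ^ Suc i / of_nat (Suc i)) \<longlonglongrightarrow> padic_log q"
    using padic_log_sums[OF assms] by (simp only: sums_def)
  fix n
  show "vnorm (\<Sum>i<n. (- 1) ^ i * (q - 1) ^ Suc i / of_nat (Suc i)) \<le> vnorm (q - 1)"
  proof (rule vnorm_sum_le)
    fix i
    have "vnorm ((- 1) ^ i * (q - 1) ^ Suc i / of_nat (Suc i)) = vnorm ((q - 1) ^ Suc i / of_nat (Suc i))"
      by (simp only: vnorm_divide vnorm_mult vnorm_power) simp
    also have "\<dots> \<le> vnorm (q - 1) * (vnorm (q - 1) / rad) ^ i" by (rule vnorm_power_div_le)
    also have "\<dots> \<le> vnorm (q - 1)"
      using assms rad_pos by (intro mult_left_le power_le_one) auto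
    finally show "vnorm ((- 1) ^ i * (q - 1) ^ Suc i / of_nat (Suc i)) \<le> vnorm (q - 1)" .
  qed simp
qed

text \<open>The binomial coefficients of \<open>m = p\<^sup>M - 1\<close> approach those of \<open>-1\<close>: by Pascal's rule the
  differences \<open>D\<^sub>j = C(m, j) - (-1)\<^sup>j\<close> satisfy \<open>D\<^bsub>j + 1\<^esub> = C(m + 1, j + 1) - D\<^sub>j\<close>, and
  \<open>C(m + 1, j + 1) = (m + 1) / (j + 1) \<cdot> C(m, j)\<close>.\<close>

lemma vnorm_binomial_minus_sign:
  "vnorm (of_nat (m choose j) - (- 1) ^ j :: 'a) * vnorm (fact j :: 'a) \<le> vnorm (of_nat (Suc m) :: 'a)"
proof (induction j)
  case (Suc j)
  define A D where "A = (of_nat (Suc m choose Suc j) :: 'a)"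
    and "D = (of_nat (m choose j) - (- 1) ^ j :: 'a)"
  have eq: "of_nat (m choose Suc j) - (- 1) ^ Suc j = A - D"
    by (simp add: A_def D_def)
  have "A * fact (Suc j) = (of_nat (Suc j) * A) * fact j"
    by (simp only: fact_Suc mult_ac)
  also have "of_nat (Suc j) * A = of_nat (Suc m) * of_nat (m choose j)"
    unfolding A_def of_nat_mult[symmetric] by (simp only: Suc_times_binomial)
  finally have "vnorm A * vnorm (fact (Suc j) :: 'a)
      = vnorm (of_nat (Suc m) :: 'a) * (vnorm (of_nat (m choose j) :: 'a) * vnorm (fact j :: 'a))"
    unfolding vnorm_mult[symmetric] by (simp only: mult.assoc)
  also have "\<dots> \<le> vnorm (of_nat (Suc m) :: 'a)"
    using vnorm_of_nat_le_1[of "m choose j", where 'a = 'a] vnorm_fact_le_1[of j]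
    by (intro mult_left_le mult_le_one) auto
  finally have A: "vnorm A * vnorm (fact (Suc j) :: 'a) \<le> vnorm (of_nat (Suc m) :: 'a)" .
  have "vnorm (fact (Suc j) :: 'a) \<le> vnorm (fact j :: 'a)"
    using vnorm_of_nat_mult_le[of "Suc j" "fact j"] by (simp del: of_nat_Suc)
  then have D: "vnorm D * vnorm (fact (Suc j) :: 'a) \<le> vnorm (of_nat (Suc m) :: 'a)"
    using Suc.IH mult_left_mono[of "vnorm (fact (Suc j) :: 'a)" "vnorm (fact j :: 'a)" "vnorm D"]
    unfolding D_def[symmetric] by simp
  have "vnorm (A - D) * vnorm (fact (Suc j) :: 'a)
      \<le> max (vnorm A) (vnorm D) * vnorm (fact (Suc j) :: 'a)"
    using vnorm_diff_le_max by (rule mult_right_mono) simp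
  also have "\<dots> \<le> vnorm (of_nat (Suc m) :: 'a)" using A D by (simp add: max_def)
  finally show ?case unfolding eq .
qed simp

text \<open>The approximation \<open>log (1 + u) = lim ((1 + u)\<^sup>n - 1) / n\<close> along \<open>n = p\<^sup>M\<close>.  By the
  preceding lemma and \<open>\<bar>(j + 1)!\<bar> \<ge> r\<^sup>j\<close> the error is at most \<open>\<bar>n\<bar> \<bar>u\<bar>\<close> term by
  term, uniformly in \<open>j\<close>.\<close>

lemma padic_log_approximation:
  assumes "vnorm (u :: 'a) < rad" and "n > 0"
  shows "vnorm (((1 + u) ^ n - 1) / of_nat n - (\<Sum>j<n. (- 1) ^ j * u ^ Suc j / of_nat (Suc j)))
    \<le> vnorm (of_nat n :: 'a) * vnorm u"
proof -
  obtain m where m: "n = Suc m" using assms(2) by (cases n) auto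
  have "((1 + u) ^ n - 1) / of_nat n = (\<Sum>j<n. of_nat (m choose j) * (u ^ Suc j / of_nat (Suc j)))"
    unfolding m power_minus_1_eq by (simp add: lessThan_Suc_atMost del: power_Suc of_nat_Suc)
  then have eq: "((1 + u) ^ n - 1) / of_nat n - (\<Sum>j<n. (- 1) ^ j * u ^ Suc j / of_nat (Suc j))
      = (\<Sum>j<n. (of_nat (m choose j) - (- 1) ^ j) * (u ^ Suc j / of_nat (Suc j)))"
    by (simp only: sum_subtractf[symmetric] left_diff_distrib times_divide_eq_right diff_divide_distrib)
  show ?thesis
    unfolding eq
  proof (rule vnorm_sum_le)
    fix j
    define D where "D = vnorm (of_nat (m choose j) - (- 1) ^ j :: 'a)"
    have f: "vnorm (of_nat (Suc j) :: 'a) * vnorm (fact j :: 'a) = vnorm (fact (Suc j) :: 'a)"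
      unfolding vnorm_mult[symmetric] by simp
    have "vnorm ((of_nat (m choose j) - (- 1) ^ j) * (u ^ Suc j / of_nat (Suc j)))
        = (D * vnorm (fact j :: 'a)) * vnorm (u ^ Suc j / fact (Suc j))"
      unfolding vnorm_mult vnorm_divide f[symmetric] D_def
      using vnorm_fact_pos[of j] by simp
    also have "\<dots> \<le> vnorm (of_nat n :: 'a) * vnorm u"
    proof (rule mult_mono)
      show "D * vnorm (fact j :: 'a) \<le> vnorm (of_nat n :: 'a)"
        unfolding D_def m by (rule vnorm_binomial_minus_sign)
      have "vnorm (u ^ Suc j / fact (Suc j)) \<le> vnorm u * (vnorm u / rad) ^ j"
        by (rule vnorm_power_div_fact_le)
      also have "\<dots> \<le> vnorm u"
        using assms rad_pos by (intro mult_left_le power_le_one) auto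
      finally show "vnorm (u ^ Suc j / fact (Suc j)) \<le> vnorm u" .
    qed auto
    finally show "vnorm ((of_nat (m choose j) - (- 1) ^ j) * (u ^ Suc j / of_nat (Suc j)))
        \<le> vnorm (of_nat n :: 'a) * vnorm u" .
  qed simp
qed

lemma inverse_p_power_tendsto: "(\<lambda>M. (1 / real p) ^ M * c) \<longlonglongrightarrow> 0"
  using tendsto_mult[OF LIMSEQ_power_zero[of "1 / real p"] tendsto_const[of c]] p_gt_1 by simp

lemma padic_log_eq_lim:
  assumes "vnorm (q - 1 :: 'a) < rad"
  shows "(\<lambda>M. (q ^ p ^ M - 1) / of_nat (p ^ M)) \<longlonglongrightarrow> padic_log q"
proof -
  let ?x = "\<lambda>M. (q ^ p ^ M - 1) / of_nat (p ^ M)"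
  let ?s = "\<lambda>n. \<Sum>j<n. (- 1) ^ j * (q - 1) ^ Suc j / of_nat (Suc j)"
  have "vnorm (?x M - ?s (p ^ M)) \<le> (1 / real p) ^ M * vnorm (q - 1)" for M
    using padic_log_approximation[OF assms, of "p ^ M"] p_gt_1 vnorm_p_power[of M] by simp
  then have "(\<lambda>M. ?x M - ?s (p ^ M)) \<longlonglongrightarrow> 0"
    by (intro tendsto_if_vnorm_le[OF _ inverse_p_power_tendsto]) (simp only: diff_zero)
  moreover have "(\<lambda>M. ?s (p ^ M)) \<longlonglongrightarrow> padic_log q"
  proof -
    have "strict_mono (\<lambda>M. p ^ M)" using p_gt_1 by (intro strict_monoI power_strict_increasing) auto
    then show ?thesis
      using LIMSEQ_subseq_LIMSEQ[of ?s "padic_log q" "\<lambda>M. p ^ M"] padic_log_sums[OF assms]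
      by (simp only: sums_def o_def)
  qed
  ultimately have "(\<lambda>M. (?x M - ?s (p ^ M)) + ?s (p ^ M)) \<longlonglongrightarrow> 0 + padic_log q"
    by (rule tendsto_add)
  then show ?thesis by (simp only: diff_add_cancel add_0_left)
qed

text \<open>With \<open>x\<^sub>M = (q\<^sup>n - 1) / n\<close>, \<open>n = p\<^sup>M\<close>,
  the first-order estimate gives \<open>exp(x\<^sub>M)\<^sup>n = exp(q\<^sup>n - 1) = q\<^sup>n + O(\<bar>n\<bar>\<^sup>2)\<close>, and since
  taking an \<open>n\<close>th power near 1 shrinks distances exactly by \<open>\<bar>n\<bar>\<close>, \<open>exp(x\<^sub>M) = q + O(\<bar>n\<bar>)\<close>.\<close>

lemma padic_exp_log:
  assumes q: "vnorm (q - 1 :: 'a) < rad"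
  shows "padic_exp (padic_log q) = q"
proof -
  define x where "x = (\<lambda>M. (q ^ p ^ M - 1) / of_nat (p ^ M))"
  have lim: "x \<longlonglongrightarrow> padic_log q"
    unfolding x_def by (rule padic_log_eq_lim[OF q])
  have log: "vnorm (padic_log q) < rad"
    using vnorm_padic_log_le[OF q] q by simp
  have q1: "vnorm q = 1" using q rad_less_1 vnorm_eq_of_diff_less[of q 1] by simp
  then have q0: "q \<noteq> 0" by auto
  have pos: "(of_nat (p ^ M) :: 'a) \<noteq> 0" for M using p_gt_1 by simp
  have power: "vnorm (q ^ p ^ M - 1) = (1 / real p) ^ M * vnorm (q - 1)" for M
    using vnorm_power_minus_1[OF q, of "p ^ M"] vnorm_p_power[of M] by simp
  have x: "vnorm (x M) = vnorm (q - 1)" for M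
    using p_gt_1 by (simp only: x_def vnorm_divide power vnorm_p_power) simp
  have bound: "vnorm (padic_exp (x M) - q) \<le> (1 / real p) ^ M * (vnorm (q - 1) ^ 2 / rad)" for M
  proof -
    define n E where "n = p ^ M" and "E = padic_exp (x M)"
    have xr: "vnorm (x M) < rad" using x q by simp
    have nx: "of_nat n * x M = q ^ n - 1" using pos[of M] by (simp add: x_def n_def)
    have En: "E ^ n = padic_exp (q ^ n - 1)"
      unfolding E_def padic_exp_of_nat_mult[OF xr, symmetric] nx ..
    have "vnorm (q ^ n - 1) < rad"
      unfolding nx[symmetric] using vnorm_of_nat_mult_le[of n "x M"] xr by simp
    from vnorm_padic_exp_first_order[OF this]
    have "vnorm (E ^ n - q ^ n) \<le> ((1 / real p) ^ M * vnorm (q - 1)) ^ 2 / rad"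
      unfolding En by (simp add: n_def power)
    moreover have "vnorm (E ^ n - q ^ n) = (1 / real p) ^ M * vnorm (E - q)"
    proof -
      have "vnorm (E - q) < rad"
        using vnorm_diff_le_max[of "E - 1" "q - 1"] vnorm_padic_exp_minus_1[OF xr] xr q
        by (simp add: E_def)
      then have v: "vnorm (E / q - 1) < rad" "vnorm (E / q - 1) = vnorm (E - q)"
        using q1 vnorm_divide[of "E - q" q] by (simp_all add: diff_divide_distrib q0)
      have "vnorm (E ^ n - q ^ n) = vnorm ((E / q) ^ n - 1)"
        using q1 vnorm_divide[of "E ^ n - q ^ n" "q ^ n"]
        by (simp add: diff_divide_distrib power_divide vnorm_power q0)
      also have "\<dots> = (1 / real p) ^ M * vnorm (E - q)"
        using vnorm_power_minus_1[OF v(1), of n] v(2) by (simp add: n_def vnorm_p_power[of M, simplified])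
      finally show ?thesis .
    qed
    ultimately have "(1 / real p) ^ M * vnorm (E - q)
        \<le> (1 / real p) ^ M * ((1 / real p) ^ M * (vnorm (q - 1) ^ 2 / rad))"
      by (simp add: power2_eq_square mult_ac)
    then have "vnorm (E - q) \<le> (1 / real p) ^ M * (vnorm (q - 1) ^ 2 / rad)"
      by (rule mult_left_le_imp_le) (use p_gt_1 in simp)
    then show ?thesis by (simp only: E_def)
  qed
  have "(\<lambda>M. padic_exp (x M)) \<longlonglongrightarrow> q"
    by (rule tendsto_if_vnorm_le[OF bound inverse_p_power_tendsto])
  moreover have "(\<lambda>M. padic_exp (x M)) \<longlonglongrightarrow> padic_exp (padic_log q)"
    using lim x q log unfolding tendsto_iff_vnorm by (simp add: padic_exp_isometry)
  ultimately show ?thesis using LIMSEQ_unique by blast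
qed

lemma vnorm_power_minus_1_le:
  assumes "vnorm (q - 1 :: 'a) < rad"
  shows "vnorm (q ^ n - 1) \<le> vnorm (q - 1)"
  using vnorm_power_minus_1[OF assms, of n] vnorm_of_nat_le_1[of n, where 'a = 'a]
    mult_left_le_one_le[of "vnorm (q - 1)" "vnorm (of_nat n :: 'a)"] by simp

lemma power_eq_1_imp_eq_1:
  assumes "vnorm (q - 1 :: 'a) < rad" and "n > 0" and "q ^ n = 1"
  shows "q = 1"
  using vnorm_power_minus_1[OF assms(1), of n] assms by simp

text \<open>Both sides lie in the disc of convergence and have the same exponential.\<close>

lemma padic_log_power:
  assumes "vnorm (q - 1 :: 'a) < rad"
  shows "padic_log (q ^ n) = of_nat n * padic_log q"
proof -
  have qn: "vnorm (q ^ n - 1) < rad" using vnorm_power_minus_1_le[OF assms, of n] assms by simp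
  have l: "vnorm (padic_log q) < rad" "vnorm (padic_log (q ^ n)) < rad"
    using vnorm_padic_log_le[OF assms] vnorm_padic_log_le[OF qn] assms qn by auto
  have nl: "vnorm (of_nat n * padic_log q) < rad"
    using vnorm_of_nat_mult_le[of n "padic_log q"] l by simp
  have "padic_exp (of_nat n * padic_log q) = padic_exp (padic_log (q ^ n))"
    by (simp add: padic_exp_of_nat_mult[OF l(1)] padic_exp_log[OF assms] padic_exp_log[OF qn])
  then show ?thesis using padic_exp_isometry[OF nl l(2)] by simp
qed

section \<open>The q-numbers\<close>

lemma q_power_of_nat:
  assumes "vnorm (q - 1 :: 'a) < rad"
  shows "q_power q (of_nat n) = q ^ n"
proof -
  have "vnorm (padic_log q) < rad" using vnorm_padic_log_le[OF assms] assms by simp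
  then show ?thesis by (simp add: q_power_def padic_exp_of_nat_mult padic_exp_log[OF assms])
qed

lemma q_power_minus_of_nat:
  assumes "vnorm (q - 1 :: 'a) < rad"
  shows "q_power q (- of_nat n) * q ^ n = 1"
proof -
  have "vnorm (padic_log q) < rad" using vnorm_padic_log_le[OF assms] assms by simp
  then have nl: "vnorm (of_nat n * padic_log q) < rad"
    using vnorm_of_nat_mult_le[of n "padic_log q"] by simp
  have "q_power q (- of_nat n) * q_power q (of_nat n) = 1"
    unfolding q_power_def using padic_exp_add[of "- (of_nat n * padic_log q)" "of_nat n * padic_log q"] nl
    by simp
  then show ?thesis by (simp add: q_power_of_nat[OF assms])
qed

lemma q_power_root:
  assumes "vnorm (q - 1 :: 'a) < rad" and "F > 0"
  shows "q_power (q ^ F) (of_nat t + of_nat a / of_nat F) = q ^ (a + F * t)"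
proof -
  have "(of_nat t + of_nat a / of_nat F) * padic_log (q ^ F) = of_nat (a + F * t) * padic_log q"
    using assms(2) by (simp add: padic_log_power[OF assms(1)] field_simps)
  then show ?thesis using q_power_of_nat[OF assms(1), of "a + F * t"] by (simp add: q_power_def)
qed

lemma q_number_of_nat:
  assumes "vnorm (q - 1 :: 'a) < rad"
  shows "q_number q (of_nat n) = q_int q n"
  by (simp add: q_number_def q_power_of_nat[OF assms] q_int_eq_quotient q_int_1)

text \<open>The distribution relation \<open>[F]\<^sub>q [t + a/F]\<^bsub>q^F\<^esub> = [a + F t]\<^sub>q\<close>, through which the
  fractional arguments disappear.\<close>

lemma q_number_distribution:
  assumes "vnorm (q - 1 :: 'a) < rad" and "F > 0"
  shows "q_number q (of_nat F) * q_number (q ^ F) (of_nat t + of_nat a / of_nat F) = q_int q (a + F * t)"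
proof (cases "q = 1")
  case True
  then show ?thesis using assms(2) by (simp add: q_number_def q_int_1 field_simps)
next
  case False
  then have "q ^ F \<noteq> 1" using power_eq_1_imp_eq_1[OF assms] by blast
  then show ?thesis
    using False by (simp add: q_number_def q_power_root[OF assms] q_power_of_nat[OF assms(1)] q_int_eq_quotient)
qed

text \<open>Since \<open>\<bar>q\<^sup>n - 1\<bar> = \<bar>n\<bar> \<bar>q - 1\<bar>\<close>.  In particular \<open>[d p\<^sup>M]\<^sub>q\<close> tends to 0, which drives the
  convergence of the sums defining the measure.\<close>

lemma vnorm_q_int:
  assumes "vnorm (q - 1 :: 'a) < rad"
  shows "vnorm (q_int q n) = vnorm (of_nat n :: 'a)"
proof (cases "q = 1")
  case False
  then show ?thesis
    using vnorm_power_minus_1[OF assms, of n] q_int_geometric[of q n] vnorm_mult[of "q_int q n" "q - 1"]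
    by simp
qed (simp add: q_int_1)

end

section \<open>Alternating sums of powers of q-numbers\<close>

definition euler_term :: "nat \<Rightarrow> 'a::comm_ring_1 \<Rightarrow> nat \<Rightarrow> 'a" where
  "euler_term k q n = (- 1) ^ n * q_int q n ^ k"

lemma vnorm_power_diff_le:
  fixes x y :: "'a::ultrametric_field"
  assumes "vnorm x \<le> 1" and "vnorm y \<le> 1"
  shows "vnorm (x ^ k - y ^ k) \<le> vnorm (x - y)"
proof -
  have "vnorm (\<Sum>i<k. y ^ (k - Suc i) * x ^ i) \<le> 1"
    using assms by (intro vnorm_sum_le) (auto simp: vnorm_mult vnorm_power intro!: mult_le_one power_le_one)
  then show ?thesis
    unfolding power_diff_sumr2 vnorm_mult by (simp add: mult_left_le)
qed

lemma sum_minus_one_powers: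
  "odd n \<Longrightarrow> (\<Sum>j<n. (- 1) ^ j) = (1 :: 'a::comm_ring_1)"
proof -
  have "(\<Sum>j<n. (- 1) ^ j) = (if odd n then 1 else 0 :: 'a)" by (induction n) auto
  then show "odd n \<Longrightarrow> (\<Sum>j<n. (- 1) ^ j) = (1 :: 'a)" by simp
qed

lemma sum_lessThan_mult:
  fixes f :: "nat \<Rightarrow> 'a::comm_monoid_add"
  shows "(\<Sum>n<m * D. f n) = (\<Sum>n<D. \<Sum>j<m. f (j * D + n))"
proof -
  have "(\<Sum>n<m * D. f n) = (\<Sum>j<m. sum f {j * D..<j * D + D})"
    by (rule sum.nat_group[symmetric])
  also have "\<dots> = (\<Sum>j<m. \<Sum>n<D. f (j * D + n))"
    by (subst sum.atLeastLessThan_shift_0) (simp add: atLeast0LessThan)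
  also have "\<dots> = (\<Sum>n<D. \<Sum>j<m. f (j * D + n))" by (rule sum.swap)
  finally show ?thesis .
qed

context complex_padic_field
begin

lemma vnorm_q_int_le_1:
  assumes "vnorm (q - 1 :: 'a) < rad"
  shows "vnorm (q_int q n) \<le> 1"
  by (simp add: vnorm_q_int[OF assms] vnorm_of_nat_le_1)

lemma vnorm_euler_term_le_1:
  assumes "vnorm (q - 1 :: 'a) < rad"
  shows "vnorm (euler_term k q n) \<le> 1"
  using vnorm_q_int_le_1[OF assms, of n]
  by (simp add: euler_term_def vnorm_mult vnorm_power power_le_one)

lemma euler_term_shift:
  assumes q: "vnorm (q - 1 :: 'a) < rad" and "odd D"
  shows "vnorm (euler_term k q (j * D + n) - (- 1) ^ j * euler_term k q n) \<le> vnorm (of_nat D :: 'a)"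
proof -
  have q1: "vnorm q = 1" using q rad_less_1 vnorm_eq_of_diff_less[of q 1] by simp
  have "(- 1 :: 'a) ^ (j * D + n) = (- 1) ^ j * (- 1) ^ n"
    using assms(2) by (simp add: power_add minus_one_power_iff)
  then have "euler_term k q (j * D + n) - (- 1) ^ j * euler_term k q n
      = (- 1) ^ j * (- 1) ^ n * (q_int q (n + j * D) ^ k - q_int q n ^ k)"
    by (simp add: euler_term_def algebra_simps)
  then have "vnorm (euler_term k q (j * D + n) - (- 1) ^ j * euler_term k q n)
      = vnorm (q_int q (n + j * D) ^ k - q_int q n ^ k)"
    by (simp add: vnorm_mult vnorm_power)
  also have "\<dots> \<le> vnorm (q_int q (n + j * D) - q_int q n)"
    by (intro vnorm_power_diff_le vnorm_q_int_le_1 q)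
  also have "\<dots> = vnorm (of_nat (j * D) :: 'a)"
    by (simp add: q_int_add vnorm_mult vnorm_power q1 vnorm_q_int[OF q])
  also have "\<dots> \<le> vnorm (of_nat D :: 'a)"
    using vnorm_of_nat_mult_le[of j "of_nat D"] by simp
  finally show ?thesis .
qed

text \<open>Passing from modulus \<open>D = d p\<^sup>M\<close> to \<open>p D\<close> replaces each \<open>n < D\<close> by its lifts \<open>n + j D\<close>,
  \<open>j < p\<close>.  Their terms are \<open>(-1)\<^sup>j\<close> times that of \<open>n\<close> up to \<open>\<bar>D\<bar>\<close>, and the \<open>p\<close> signs
  add up to 1 because \<open>p\<close> is odd; so the sum changes by at most \<open>\<bar>D\<bar>\<close>.\<close>

lemma convergent_euler_sum:
  assumes q: "vnorm (q - 1 :: 'a) < rad" and p: "odd p" and d: "odd d"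
    and periodic: "\<And>m n. m mod (d * p ^ N) = n mod (d * p ^ N) \<Longrightarrow> P m = P n"
  shows "convergent (\<lambda>M. \<Sum>n | n < d * p ^ M \<and> P n. euler_term k q n)"
proof (rule convergent_if_steps_tendsto_0)
  define S where "S = (\<lambda>M. \<Sum>n | n < d * p ^ M \<and> P n. euler_term k q n)"
  have S_eq: "S M = (\<Sum>n<d * p ^ M. if P n then euler_term k q n else 0)" for M
    unfolding S_def by (simp add: sum.If_cases Int_def)
  have step: "vnorm (S (Suc M) - S M) \<le> (1 / real p) ^ M * 1" if "M \<ge> N" for M
  proof -
    define D where "D = d * p ^ M"
    have "odd D" using p d by (simp add: D_def)
    have "d * p ^ N dvd D" using that by (auto simp: D_def le_imp_power_dvd intro!: mult_dvd_mono)
    then have P: "P (j * D + n) = P n" for j n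
      by (intro periodic) (metis dvd_mult mod_add_self2 add.commute dvd_def mod_mult_self2 mult.assoc)
    have "S (Suc M) = (\<Sum>n<p * D. if P n then euler_term k q n else 0)"
      unfolding S_eq by (simp add: D_def mult_ac)
    also have "\<dots> = (\<Sum>n<D. \<Sum>j<p. if P n then euler_term k q (j * D + n) else 0)"
      unfolding sum_lessThan_mult P ..
    finally have "S (Suc M) - S M = (\<Sum>n<D. (\<Sum>j<p. if P n then euler_term k q (j * D + n) else 0)
        - (\<Sum>j<p. (- 1) ^ j) * (if P n then euler_term k q n else 0))"
      unfolding S_eq[of M] sum_minus_one_powers[OF p] D_def by (simp add: sum_subtractf)
    also have "\<dots> = (\<Sum>n<D. \<Sum>j<p. if P n then euler_term k q (j * D + n) - (- 1) ^ j * euler_term k q n else 0)"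
      unfolding sum_distrib_right sum_subtractf[symmetric] by (intro sum.cong) auto
    finally have eq: "S (Suc M) - S M = \<dots>" .
    have "vnorm (of_nat D :: 'a) \<le> (1 / real p) ^ M"
      using vnorm_of_nat_mult_le[of d "of_nat (p ^ M)"] by (simp only: D_def of_nat_mult vnorm_p_power)
    then show ?thesis
      unfolding eq using order_trans[OF euler_term_shift[OF q \<open>odd D\<close>]]
      by (intro vnorm_sum_le) (simp_all split: if_split)
  qed
  have "(\<lambda>M. vnorm (S (Suc M) - S M)) \<longlonglongrightarrow> 0"
    by (rule tendsto_sandwich[OF _ _ tendsto_const inverse_p_power_tendsto[of 1]])
      (use step in \<open>auto simp: eventually_sequentially\<close>)
  then show "(\<lambda>M. vnorm ((\<Sum>n | n < d * p ^ Suc M \<and> P n. euler_term k q n)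
      - (\<Sum>n | n < d * p ^ M \<and> P n. euler_term k q n))) \<longlonglongrightarrow> 0"
    by (simp only: S_def)
qed

lemma vnorm_1_plus:
  assumes "odd p" and "vnorm (Q - 1 :: 'a) < rad"
  shows "vnorm (1 + Q) = 1"
proof -
  have "vnorm (2 :: 'a) = 1"
    using vnorm_of_nat_coprime[of 2] assms(1) by simp
  then show ?thesis
    using vnorm_eq_of_diff_less[of "1 + Q" 2] assms(2) rad_less_1 by (simp add: algebra_simps)
qed

text \<open>Since \<open>Q\<^bsup>-t\<^esup> (-Q)\<^sup>t = (-1)\<^sup>t\<close> and \<open>Q\<^bsup>p^M\<^esup> \<rightarrow> 1\<close>, the integral defining the Euler
  polynomials is an alternating sum.\<close>

lemma q_euler_poly_eq:
  assumes p: "odd p" and Q: "vnorm (Q - 1 :: 'a) < rad"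
    and L: "(\<lambda>M. \<Sum>t<p ^ M. (- 1) ^ t * q_number Q (of_nat t + x) ^ k) \<longlonglongrightarrow> L"
  shows "q_euler_poly p k Q x = (1 + Q) / 2 * L"
proof -
  let ?c = "\<lambda>M. 1 / neg_q_number Q (p ^ M)"
  have Q2: "vnorm (1 + Q) = 1" by (rule vnorm_1_plus[OF p Q])
  have QM: "vnorm (1 + Q ^ p ^ M) = 1" for M
    using vnorm_power_minus_1_le[OF Q, of "p ^ M"] Q by (intro vnorm_1_plus[OF p]) simp
  have c_eq: "?c M = (1 + Q) / (1 + Q ^ p ^ M)" for M
    using p by (simp add: neg_q_number_def)
  have "vnorm (?c M - (1 + Q) / 2) \<le> (1 / real p) ^ M * vnorm (Q - 1)" for M
  proof -
    have nz: "1 + Q ^ p ^ M \<noteq> 0" using QM[of M] by auto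
    have "vnorm (2 :: 'a) = 1" using vnorm_1_plus[OF p, of 1] rad_pos by simp
    moreover have "?c M - (1 + Q) / 2 = (1 + Q) * (1 - Q ^ p ^ M) / ((1 + Q ^ p ^ M) * 2)"
      unfolding c_eq using nz by (simp add: field_simps)
    ultimately have "vnorm (?c M - (1 + Q) / 2) = vnorm (1 - Q ^ p ^ M)"
      by (simp only: vnorm_divide vnorm_mult Q2 QM div_by_1 mult_1_left mult_1_right)
    then show ?thesis
      using vnorm_power_minus_1[OF Q, of "p ^ M"] vnorm_p_power[of M] vnorm_diff_commute[of 1 "Q ^ p ^ M"]
      by simp
  qed
  then have c: "?c \<longlonglongrightarrow> (1 + Q) / 2"
    by (rule tendsto_if_vnorm_le[OF _ inverse_p_power_tendsto])
  have term_eq: "q_power Q (- of_nat t) * q_number Q (of_nat t + x) ^ k * (- Q) ^ t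
      = (- 1) ^ t * q_number Q (of_nat t + x) ^ k" for t
  proof -
    have "(- Q) ^ t = (- 1) ^ t * Q ^ t" by (metis mult_minus1 power_mult_distrib)
    then have "q_power Q (- of_nat t) * q_number Q (of_nat t + x) ^ k * (- Q) ^ t
      = (- 1) ^ t * q_number Q (of_nat t + x) ^ k * (q_power Q (- of_nat t) * Q ^ t)"
      by (simp only: mult_ac)
    then show ?thesis by (simp only: q_power_minus_of_nat[OF Q] mult_1_right)
  qed
  show ?thesis
    unfolding q_euler_poly_def fermionic_integral_def term_eq
    by (intro limI tendsto_mult c L)
qed

text \<open>By the distribution relation the factor \<open>[F]\<^sub>q\<^sup>k\<close> turns \<open>[t + a/F]\<close> to the base \<open>q\<^sup>F\<close> into
  \<open>[a + F t]\<^sub>q\<close>, and \<open>(-1)\<^sup>a (-1)\<^sup>t = (-1)\<^bsup>a + F t\<^esup>\<close> because \<open>F\<close> is odd.  The factors \<open>1 + q\<^sup>F\<close> from the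
  integral and from \<open>[2]\<close> to the base \<open>q\<^sup>F\<close> cancel.\<close>

lemma mu_star_eq:
  fixes q :: 'a and d N :: nat
  defines "F \<equiv> d * p ^ N"
  assumes p: "odd p" and q: "vnorm (q - 1) < rad" and d: "odd d"
    and L: "(\<lambda>M. \<Sum>t<p ^ M. euler_term k q (a + F * t)) \<longlonglongrightarrow> L"
  shows "mu_star p d k q N a = (1 + q) / 2 * L"
proof -
  have oddF: "odd F" using p d by (simp add: F_def)
  then have F: "F > 0" by (simp add: odd_pos)
  define Q x where "Q = q ^ F" and "x = (of_nat a / of_nat F :: 'a)"
  have Qr: "vnorm (Q - 1) < rad"
    using vnorm_power_minus_1_le[OF q, of F] q by (simp add: Q_def)
  define b where "b = q_number q (of_nat F)"
  \<comment> \<open>\<open>\<bar>[F]\<^sub>q\<bar> = \<bar>F\<bar>\<close>, so dividing by \<open>[F]\<^sub>q\<^sup>k\<close> yields the limit of the sums in the integral\<close>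
  have "b \<noteq> 0"
    using vnorm_q_int[OF q, of F] F vnorm_eq_0_iff[of b] vnorm_eq_0_iff[of "of_nat F :: 'a"]
    by (auto simp: b_def q_number_of_nat[OF q])
  have sign: "(- 1 :: 'a) ^ (a + F * t) = (- 1) ^ a * (- 1) ^ t" for t
    using oddF by (simp add: power_add minus_one_power_iff)
  have "euler_term k q (a + F * t) = (- 1) ^ a * b ^ k * ((- 1) ^ t * q_number Q (of_nat t + x) ^ k)" for t
    unfolding euler_term_def sign q_number_distribution[OF q F, of t a, symmetric]
    by (simp add: power_mult_distrib b_def Q_def x_def mult_ac)
  then have "(- 1) ^ t * q_number Q (of_nat t + x) ^ k = (- 1) ^ a / b ^ k * euler_term k q (a + F * t)" for t
    using \<open>b \<noteq> 0\<close> by (simp add: minus_one_power_iff)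
  then have "(\<lambda>M. \<Sum>t<p ^ M. (- 1) ^ t * q_number Q (of_nat t + x) ^ k) \<longlonglongrightarrow> (- 1) ^ a / b ^ k * L"
    using tendsto_mult[OF tendsto_const[of "(- 1) ^ a / b ^ k"] L] by (simp add: sum_distrib_left)
  then have E: "q_euler_poly p k Q x = (1 + Q) / 2 * ((- 1) ^ a / b ^ k * L)"
    by (rule q_euler_poly_eq[OF p Qr])
  have two: "q_number r 2 = 1 + r" if "vnorm (r - 1) < rad" for r :: 'a
    using q_number_of_nat[OF that, of 2] by (simp add: q_int_def numeral_2_eq_2)
  have "1 + Q \<noteq> 0" using vnorm_1_plus[OF p Qr] by auto
  then show ?thesis
    unfolding mu_star_def F_def[symmetric] Q_def[symmetric] x_def[symmetric] b_def[symmetric] E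
      two[OF q] two[OF Qr]
    using \<open>b \<noteq> 0\<close> by (simp add: minus_one_power_iff)
qed

end

section \<open>Compact open subsets of the profinite space\<close>

lemma X_set_mod:
  assumes "x \<in> X_set p d" and "M \<le> N"
  shows "x N mod (d * p ^ M) = x M"
  using assms(2)
proof (induction N rule: dec_induct)
  case base
  show ?case using assms(1) by (simp add: X_set_def)
next
  case (step N)
  have "d * p ^ M dvd d * p ^ N" using step by (auto simp: le_imp_power_dvd intro!: mult_dvd_mono)
  then have "x (Suc N) mod (d * p ^ M) = x (Suc N) mod (d * p ^ N) mod (d * p ^ M)"
    by (simp add: mod_mod_cancel)
  then show ?case using assms(1) step by (simp add: X_set_def)
qed

lemma X_set_eq_mono:
  assumes "x \<in> X_set p d" and "y \<in> X_set p d" and "x N = y N" and "M \<le> N"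
  shows "x M = y M"
  using X_set_mod[OF assms(1,4)] X_set_mod[OF assms(2,4)] assms(3) by simp

lemma openin_X_top_level:
  assumes "openin (X_top p d) U" and x: "x \<in> U"
  shows "\<exists>N. \<forall>y\<in>X_set p d. y N = x N \<longrightarrow> y \<in> U"
proof -
  obtain T where T: "openin (product_topology (\<lambda>N. discrete_topology {..<d * p ^ N}) UNIV) T"
    and U: "U = T \<inter> X_set p d"
    using assms(1) unfolding X_top_def openin_subtopology by blast
  obtain V where fin: "finite {i. V i \<noteq> {..<d * p ^ i}}"
    and xV: "x \<in> Pi\<^sub>E UNIV V" and VT: "Pi\<^sub>E UNIV V \<subseteq> T"
    using T x U unfolding openin_product_topology_alt by fastforce
  obtain N where N: "\<And>i. V i \<noteq> {..<d * p ^ i} \<Longrightarrow> i \<le> N"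
    using finite_nat_set_iff_bounded_le[THEN iffD1, OF fin] by auto
  have "y \<in> U" if y: "y \<in> X_set p d" "y N = x N" for y
  proof -
    have "y i \<in> V i" for i
    proof (cases "V i = {..<d * p ^ i}")
      case True
      then show ?thesis using y by (simp add: X_set_def)
    next
      case False
      then have "y i = x i"
        using X_set_eq_mono[of y p d x N i] y x U N[of i] by auto
      then show ?thesis using xV by auto
    qed
    then show ?thesis using VT U y by auto
  qed
  then show ?thesis by blast
qed

lemma topspace_X_top: "topspace (X_top p d) = X_set p d"
  by (auto simp: X_top_def X_set_def)

lemma openin_X_ball:
  assumes "a < d * p ^ N"
  shows "openin (X_top p d) (X_ball p d N a)"
proof -
  let ?T = "product_topology (\<lambda>N. discrete_topology {..<d * p ^ N}) UNIV"
  have "openin ?T {x \<in> topspace ?T. x N \<in> {a}}"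
    using assms by (intro openin_continuous_map_preimage[OF continuous_map_product_projection]) auto
  moreover have "X_ball p d N a = {x \<in> topspace ?T. x N \<in> {a}} \<inter> X_set p d"
    by (auto simp: X_ball_def X_set_def)
  ultimately show ?thesis unfolding X_top_def openin_subtopology by blast
qed

text \<open>By compactness finitely many of the neighbourhoods of its points cover a compact open set;
  the largest of their levels determines the set.\<close>

lemma compact_open_X_top_level:
  assumes "compact_open (X_top p d) U"
  shows "\<exists>N. \<forall>x\<in>X_set p d. \<forall>y\<in>X_set p d. x N = y N \<longrightarrow> x \<in> U \<longrightarrow> y \<in> U"
proof -
  have sub: "U \<subseteq> X_set p d" and op: "openin (X_top p d) U" and co: "compactin (X_top p d) U"
    using assms compactin_subset_topspace[of "X_top p d" U] by (auto simp: compact_open_def topspace_X_top)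
  have "\<forall>x\<in>U. \<exists>N. \<forall>y\<in>X_set p d. y N = x N \<longrightarrow> y \<in> U"
    using openin_X_top_level[OF op] by blast
  then obtain l where l: "\<And>x y. x \<in> U \<Longrightarrow> y \<in> X_set p d \<Longrightarrow> y (l x) = x (l x) \<Longrightarrow> y \<in> U"
    by metis
  let ?B = "\<lambda>x. X_ball p d (l x) (x (l x))"
  have "\<exists>\<F>. finite \<F> \<and> \<F> \<subseteq> ?B ` U \<and> U \<subseteq> \<Union>\<F>"
  proof (rule compactinD[OF co])
    fix V assume "V \<in> ?B ` U"
    then obtain x where "x \<in> U" and V: "V = ?B x" by (elim imageE)
    then have "x (l x) < d * p ^ l x" using sub by (auto simp: X_set_def)
    then show "openin (X_top p d) V" unfolding V by (rule openin_X_ball)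
  next
    show "U \<subseteq> \<Union>(?B ` U)" using sub by (auto simp: X_ball_def)
  qed
  then obtain \<F> where F: "finite \<F>" "\<F> \<subseteq> ?B ` U" "U \<subseteq> \<Union>\<F>" by (elim exE conjE)
  obtain C where C: "C \<subseteq> U" "finite C" and "\<F> = ?B ` C"
    using finite_subset_image[OF F(1,2)] by (elim exE conjE)
  then have cover: "U \<subseteq> \<Union>(?B ` C)" using F(3) by simp
  define N where "N = Max (insert 0 (l ` C))"
  have "y \<in> U" if xy: "x \<in> X_set p d" "y \<in> X_set p d" "x N = y N" "x \<in> U" for x y
  proof -
    obtain c where c: "c \<in> C" "x (l c) = c (l c)" using cover xy(4) by (auto simp: X_ball_def)
    have "l c \<le> N" using c C(2) by (simp add: N_def)
    then have "y (l c) = c (l c)" using X_set_eq_mono[OF xy(1-3)] c(2) by simp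
    then show ?thesis using l[of c y] c(1) C(1) xy(2) by auto
  qed
  then show ?thesis by blast
qed

text \<open>The embedding of the natural numbers into the inverse limit.\<close>

definition residues_of :: "nat \<Rightarrow> nat \<Rightarrow> nat \<Rightarrow> nat \<Rightarrow> nat" where
  "residues_of p d n = (\<lambda>N. n mod (d * p ^ N))"

lemma residues_of_in_X_set:
  assumes "p > 0" and "d > 0"
  shows "residues_of p d n \<in> X_set p d"
  using assms by (auto simp: X_set_def residues_of_def intro!: mod_mod_cancel mult_dvd_mono)

lemma residues_of_in_compact_open:
  assumes "p > 0" and "d > 0" and "compact_open (X_top p d) U"
  shows "\<exists>N. \<forall>m n. m mod (d * p ^ N) = n mod (d * p ^ N) \<longrightarrow>
    (residues_of p d m \<in> U) = (residues_of p d n \<in> U)"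
proof -
  obtain N where N: "\<forall>x\<in>X_set p d. \<forall>y\<in>X_set p d. x N = y N \<longrightarrow> x \<in> U \<longrightarrow> y \<in> U"
    using compact_open_X_top_level[OF assms(3)] by (elim exE)
  have imp: "residues_of p d n \<in> U"
    if "m mod (d * p ^ N) = n mod (d * p ^ N)" "residues_of p d m \<in> U" for m n
  proof (rule N[rule_format])
    show "residues_of p d m \<in> X_set p d" "residues_of p d n \<in> X_set p d"
      by (rule residues_of_in_X_set[OF assms(1,2)])+
    show "residues_of p d m N = residues_of p d n N" using that(1) by (simp add: residues_of_def)
    show "residues_of p d m \<in> U" by (rule that(2))
  qed
  show ?thesis
  proof (intro exI[of _ N] allI impI iffI)
    fix m n assume eq: "m mod (d * p ^ N) = n mod (d * p ^ N)"
    show "residues_of p d n \<in> U" if "residues_of p d m \<in> U" by (rule imp[OF eq that])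
    show "residues_of p d m \<in> U" if "residues_of p d n \<in> U" by (rule imp[OF eq[symmetric] that])
  qed
qed

lemma sum_residue_class:
  fixes f :: "nat \<Rightarrow> 'b::comm_monoid_add"
  assumes "a < F"
  shows "(\<Sum>n | n < F * m \<and> n mod F = a. f n) = (\<Sum>t<m. f (a + F * t))"
proof -
  have "{n. n < F * m \<and> n mod F = a} = (\<lambda>t. a + F * t) ` {..<m}"
  proof (intro equalityI subsetI)
    fix n assume "n \<in> {n. n < F * m \<and> n mod F = a}"
    then have "n < m * F" and "n mod F = a" by (simp_all add: mult.commute)
    then have "n = a + F * (n div F)" and "n div F < m"
      using mod_mult_div_eq[of n F] by (simp_all only: less_mult_imp_div_less)
    then show "n \<in> (\<lambda>t. a + F * t) ` {..<m}" by blast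
  next
    fix n assume "n \<in> (\<lambda>t. a + F * t) ` {..<m}"
    then obtain t where t: "n = a + F * t" "t < m" by auto
    have "a + F * t < F * Suc t" using assms by simp
    also have "\<dots> \<le> F * m" using t(2) by (intro mult_left_mono) auto
    finally show "n \<in> {n. n < F * m \<and> n mod F = a}" using t(1) assms by simp
  qed
  moreover have "inj_on (\<lambda>t. a + F * t) {..<m}" using assms by (auto simp: inj_on_def)
  ultimately show ?thesis by (simp add: sum.reindex)
qed

section \<open>The measure\<close>

text \<open>Counting \<open>n\<close> with weight \<open>(1 + q) / 2 \<cdot> (-1)\<^sup>n [n]\<^sub>q\<^sup>k\<close> in the order given by the moduli
  \<open>d p\<^sup>M\<close>.  The formula makes sense for an arbitrary set \<open>U\<close>, so that additivity is additivity of
  finite sums and no decomposition into balls has to be chosen; on compact open sets the limit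
  exists.\<close>

definition euler_measure :: "nat \<Rightarrow> nat \<Rightarrow> nat \<Rightarrow> 'a::ultrametric_field \<Rightarrow> (nat \<Rightarrow> nat) set \<Rightarrow> 'a" where
  "euler_measure p d k q U =
     (1 + q) / 2 * lim (\<lambda>M. \<Sum>n | n < d * p ^ M \<and> residues_of p d n \<in> U. euler_term k q n)"

context complex_padic_field
begin

lemma euler_measure_sums:
  assumes "vnorm (q - 1 :: 'a) < rad" and "odd p" and "odd d" and "compact_open (X_top p d) U"
  shows "(\<lambda>M. \<Sum>n | n < d * p ^ M \<and> residues_of p d n \<in> U. euler_term k q n) \<longlonglongrightarrow>
    lim (\<lambda>M. \<Sum>n | n < d * p ^ M \<and> residues_of p d n \<in> U. euler_term k q n)"
proof -
  have "p > 0" "d > 0" using assms(2,3) by (auto simp: odd_pos)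
  obtain N where N: "\<forall>m n. m mod (d * p ^ N) = n mod (d * p ^ N) \<longrightarrow>
      (residues_of p d m \<in> U) = (residues_of p d n \<in> U)"
    using residues_of_in_compact_open[OF \<open>p > 0\<close> \<open>d > 0\<close> assms(4)] by (elim exE)
  show ?thesis
    unfolding convergent_LIMSEQ_iff[symmetric]
    by (rule convergent_euler_sum[OF assms(1-3), of N]) (rule N[rule_format])
qed

lemma padic_measure_euler_measure:
  assumes "vnorm (q - 1 :: 'a) < rad" and "odd p" and "odd d"
  shows "padic_measure (X_top p d) (euler_measure p d k q)"
proof -
  let ?S = "\<lambda>U M. \<Sum>n | n < d * p ^ M \<and> residues_of p d n \<in> U. euler_term k q n"
  note lim = euler_measure_sums[OF assms]
  have "vnorm (euler_measure p d k q U) \<le> vnorm ((1 + q) / 2)" if "compact_open (X_top p d) U" for U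
  proof -
    have "vnorm (lim (?S U)) \<le> 1"
      by (rule vnorm_limit_le[OF lim[OF that], where N = 0])
        (intro vnorm_sum_le vnorm_euler_term_le_1 assms(1) zero_le_one)
    then show ?thesis unfolding euler_measure_def vnorm_mult by (intro mult_left_le) auto
  qed
  moreover have "euler_measure p d k q (U \<union> V) = euler_measure p d k q U + euler_measure p d k q V"
    if U: "compact_open (X_top p d) U" and V: "compact_open (X_top p d) V" and "U \<inter> V = {}" for U V
  proof -
    have "?S (U \<union> V) M = ?S U M + ?S V M" for M
      using that(3) by (subst sum.union_disjoint[symmetric]) (auto intro!: sum.cong)
    then have "?S (U \<union> V) \<longlonglongrightarrow> lim (?S U) + lim (?S V)"
      using tendsto_add[OF lim[OF U] lim[OF V]] by simp
    then have "lim (?S (U \<union> V)) = lim (?S U) + lim (?S V)" by (rule limI)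
    then show ?thesis by (simp add: euler_measure_def algebra_simps)
  qed
  ultimately show ?thesis unfolding padic_measure_def by blast
qed

lemma euler_measure_X_ball:
  assumes q: "vnorm (q - 1 :: 'a) < rad" and p: "odd p" and d: "odd d" and a: "a < d * p ^ N"
  shows "euler_measure p d k q (X_ball p d N a) = mu_star p d k q N a"
proof -
  let ?F = "d * p ^ N"
  define S where "S = (\<lambda>M. \<Sum>n | n < d * p ^ M \<and> residues_of p d n \<in> X_ball p d N a. euler_term k q n)"
  have pd: "p > 0" "d > 0" using p d by (auto simp: odd_pos)
  have iff: "residues_of p d n \<in> X_ball p d N a \<longleftrightarrow> n mod ?F = a" for n
    using residues_of_in_X_set[OF pd, of n] by (auto simp: X_ball_def residues_of_def)
  have "convergent S"
    unfolding S_def iff by (rule convergent_euler_sum[OF q p d, of N]) simp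
  then have "S \<longlonglongrightarrow> lim S" by (simp add: convergent_LIMSEQ_iff)
  then have "(\<lambda>M. S (M + N)) \<longlonglongrightarrow> lim S" by (rule LIMSEQ_ignore_initial_segment)
  moreover have "S (M + N) = (\<Sum>t<p ^ M. euler_term k q (a + ?F * t))" for M
    unfolding S_def iff sum_residue_class[OF a, symmetric] by (simp add: power_add mult_ac)
  ultimately have "(\<lambda>M. \<Sum>t<p ^ M. euler_term k q (a + ?F * t)) \<longlonglongrightarrow> lim S" by simp
  from mu_star_eq[OF p q d this] show ?thesis by (simp add: euler_measure_def S_def)
qed

end

theorem theorem1:
  fixes p d k :: nat
    and q :: "'a::{ultrametric_field, complete_space}"
  assumes "complex_padic_field TYPE('a) p"
    and "odd p"
    and "vnorm (q - 1) < real p powr (- 1 / (real p - 1))"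
    and "k > 0" and "d > 0" and "odd d" and "coprime p d"
  shows "\<exists>\<mu> :: (nat \<Rightarrow> nat) set \<Rightarrow> 'a. padic_measure (X_top p d) \<mu> \<and>
    (\<forall>N>0. \<forall>a<d * p ^ N. \<mu> (X_ball p d N a) = mu_star p d k q N a)"
proof -
  have q: "vnorm (q - 1) < exp_radius p" using assms(3) by (simp only: exp_radius_def)
  show ?thesis
    using complex_padic_field.padic_measure_euler_measure[OF assms(1) q assms(2,6)]
      complex_padic_field.euler_measure_X_ball[OF assms(1) q assms(2,6)] by blast
qed

end
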